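(* Let $d\ge2$, $N\ge1$, $\varepsilon>0$, and let $B_1,\dots,B_N\in\mathbb{R}^{d\times d}$ be symmetric matrices with zero diagonal entries. Define $$\ell_\varepsilon(U)=\sum_{\substack{i,j=1\\ i\neq j}}^d\Big(\frac1N\sum_{n=1}^N (U^{\mathrm T}B_nU)_{i,j}^2+\varepsilon\Big)^{1/2},\qquad U\in\mathbb{R}^{d\times d}.$$ There exists $L>0$ such that the sequence $\{U^{(r)}\}_{r\ge0}$ generated from an initial guess $U^{(0)}\in SO(d)$ by Riemannian gradient descent $$U^{(r+1)}=\operatorname{Retr}\big(U^{(r)},-\nu_r\operatorname{grad}\ell_\varepsilon(U^{(r)})\big),\quad r\ge0,$$ with constant step sizes $\nu_r=\nu$, $0<\nu\le 1/L$, satisfies $$\ell_\varepsilon(U^{(r+1)})-\ell_\varepsilon(U^{(r)})\le-\tfrac{1}{2L}\,\|\operatorname{grad}\ell_\varepsilon(U^{(r)})\|_F^2,\qquad r\ge0.$$ Furthermore, $\{\ell_\varepsilon(U^{(r)})\}_{r\ge0}$ converges and $\operatorname{grad}\ell_\varepsilon(U^{(r)})\to0$ as $r\to\infty$.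
   Context: $SO(d)$ is the group of orthogonal $d\times d$ matrices with determinant $1$, regarded as a Riemannian submanifold of $\mathbb{R}^{d\times d}$ with the Frobenius inner product; its tangent space at $U$ is $T_U=\{AU:A\in\mathbb{R}^{d\times d},\ A+A^{\mathrm T}=0\}$. The Riemannian gradient is $\operatorname{grad}F(U)=\frac12\nabla F(U)-\frac12U\nabla F(U)^{\mathrm T}U$, where $\nabla F$ is the Euclidean gradient. The retraction is $\operatorname{Retr}(U,V)=\mathrm{QR}(U+V)$ for $V\in T_U$, where $\mathrm{QR}(M)$ denotes the orthogonal factor $Q$ of the QR-factorization $M=QR$ of an invertible matrix $M$, with $R$ upper triangular having positive diagonal. $\|\cdot\|_F$ is the Frobenius norm.
   Formalization: The bound with 1/(2L) is false for all 0<ν≤1/L with one L (let ν→0); the formal theorem proves decrease by (ν/2)‖grad‖² for every 0<ν≤1/L, hence the printed bound for ν=1/L, with both convergence claims for all such ν. *)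

theory Defs
  imports "HOL-Analysis.Analysis"
begin

type_synonym 'd sqmat = "real^'d^'d"

text \<open>
  A \<open>d \<times> d\<close> matrix is an element of \<open>real^'d^'d\<close> with \<open>d = CARD('d)\<close>. The library norm and inner
  product on this type are the Frobenius ones, and \<open>rotation_matrix U\<close> says \<open>U \<in> SO(d)\<close>. The index
  type is ordered (sort \<open>wellorder\<close>, as in \<open>det_upperdiagonal\<close>) so that triangularity makes sense;
  on a finite type this is the same as a linear order.
\<close>

definition upper_triangular :: "'d::{finite,wellorder} sqmat \<Rightarrow> bool" where
  "upper_triangular R \<longleftrightarrow> (\<forall>i j. j < i \<longrightarrow> R $ i $ j = 0)"

text \<open>Determined only for invertible \<open>M\<close>. If \<open>U\<close> is orthogonal and \<open>A\<close> is skew-symmetric then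
  \<open>U + A ** U\<close> is invertible, so the retraction below is well defined on tangent vectors.\<close>

definition QR_orth :: "'d::{finite,wellorder} sqmat \<Rightarrow> 'd sqmat" where
  "QR_orth M = (THE Q. orthogonal_matrix Q \<and>
     (\<exists>R. upper_triangular R \<and> (\<forall>i. 0 < R $ i $ i) \<and> M = Q ** R))"

definition Retr :: "'d::{finite,wellorder} sqmat \<Rightarrow> 'd sqmat \<Rightarrow> 'd sqmat" where
  "Retr U V = QR_orth (U + V)"

definition egrad :: "('d::finite sqmat \<Rightarrow> real) \<Rightarrow> 'd sqmat \<Rightarrow> 'd sqmat" where
  "egrad F U = (THE G. GDERIV F U :> G)"

text \<open>For orthogonal \<open>U\<close>: the orthogonal projection of the Euclidean gradient onto the tangent space
  \<open>{A ** U | A. A + transpose A = 0}\<close> of \<open>SO(d)\<close> at \<open>U\<close>.\<close>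

definition rgrad :: "('d::finite sqmat \<Rightarrow> real) \<Rightarrow> 'd sqmat \<Rightarrow> 'd sqmat" where
  "rgrad F U = (1/2) *\<^sub>R egrad F U - (1/2) *\<^sub>R (U ** transpose (egrad F U) ** U)"

definition riemannian_gd ::
  "('d::{finite,wellorder} sqmat \<Rightarrow> real) \<Rightarrow> (nat \<Rightarrow> real) \<Rightarrow> (nat \<Rightarrow> 'd sqmat) \<Rightarrow> bool" where
  "riemannian_gd F \<nu> U \<longleftrightarrow>
     rotation_matrix (U 0) \<and> (\<forall>r. U (Suc r) = Retr (U r) (- (\<nu> r *\<^sub>R rgrad F (U r))))"

definition ell :: "nat \<Rightarrow> (nat \<Rightarrow> 'd::finite sqmat) \<Rightarrow> real \<Rightarrow> 'd sqmat \<Rightarrow> real" where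
  "ell N B \<epsilon> U = (\<Sum>i\<in>UNIV. \<Sum>j\<in>UNIV - {i}.
     sqrt ((1 / real N) * (\<Sum>n=1..N. ((transpose U ** B n ** U) $ i $ j)\<^sup>2) + \<epsilon>))"

end

theory Submission
  imports Defs
begin

text \<open>
  The map \<open>\<ell>\<^sub>\<epsilon>\<close> is a sum of square roots of quartic polynomials that are bounded below by \<open>\<epsilon>\<close>.
  Concavity of the square root and the boundedness of orthogonal matrices give a constant \<open>C\<close> with
  \<open>\<ell>\<^sub>\<epsilon>(Y) \<le> \<ell>\<^sub>\<epsilon>(X) + \<langle>\<nabla>\<ell>\<^sub>\<epsilon>(X), Y - X\<rangle> + C \<parallel>Y - X\<parallel>\<^sup>2\<close> for orthogonal \<open>X\<close>, \<open>Y\<close>. For a tangent vector \<open>V\<close>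
  at \<open>U\<close> one has \<open>(U + V)\<^sup>T (U + V) = I + V\<^sup>T V\<close>, so the triangular factor of \<open>U + V\<close> differs from \<open>I\<close>
  by at most \<open>min (\<parallel>V\<parallel>, 2 \<parallel>V\<parallel>\<^sup>2)\<close>, hence the retraction agrees with \<open>U + V\<close> to second order, uniformly in
  \<open>U\<close> and \<open>V\<close>. Together these give \<open>\<ell>\<^sub>\<epsilon>(Retr(U, V)) \<le> \<ell>\<^sub>\<epsilon>(U) + \<langle>\<nabla>\<ell>\<^sub>\<epsilon>(U), V\<rangle> + (L/2) \<parallel>V\<parallel>\<^sup>2\<close>, and the choice
  \<open>V = - \<nu> grad \<ell>\<^sub>\<epsilon>(U)\<close> with \<open>\<nu> \<le> 1/L\<close> yields the decrease. Summing it and using \<open>\<ell>\<^sub>\<epsilon> \<ge> 0\<close> gives convergence.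
\<close>

subsection \<open>The Frobenius inner product\<close>

lemma inner_matrix_mult_left:
  fixes A B C :: "'d::finite sqmat"
  shows "inner (A ** B) C = inner B (transpose A ** C)"
proof -
  have "inner (A ** B) C = (\<Sum>i\<in>UNIV. \<Sum>j\<in>UNIV. \<Sum>k\<in>UNIV. A $ i $ k * B $ k $ j * C $ i $ j)"
    by (simp add: inner_vec_def matrix_matrix_mult_def sum_distrib_right)
  also have "\<dots> = (\<Sum>i\<in>UNIV. \<Sum>k\<in>UNIV. \<Sum>j\<in>UNIV. A $ i $ k * B $ k $ j * C $ i $ j)"
    by (intro sum.cong refl sum.swap)
  also have "\<dots> = (\<Sum>k\<in>UNIV. \<Sum>i\<in>UNIV. \<Sum>j\<in>UNIV. A $ i $ k * B $ k $ j * C $ i $ j)"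
    by (rule sum.swap)
  also have "\<dots> = (\<Sum>k\<in>UNIV. \<Sum>j\<in>UNIV. \<Sum>i\<in>UNIV. A $ i $ k * B $ k $ j * C $ i $ j)"
    by (intro sum.cong refl sum.swap)
  also have "\<dots> = inner B (transpose A ** C)"
    by (simp add: inner_vec_def matrix_matrix_mult_def transpose_def sum_distrib_left mult_ac)
  finally show ?thesis .
qed

lemma inner_transpose:
  fixes A B :: "'d::finite sqmat"
  shows "inner (transpose A) (transpose B) = inner A B"
  unfolding inner_vec_def transpose_def by (simp, rule sum.swap)

lemma norm_transpose: "norm (transpose A) = norm (A :: 'd::finite sqmat)"
  by (simp add: norm_eq_sqrt_inner inner_transpose)

lemma norm_orthogonal_mult_left:
  fixes Q A :: "'d::finite sqmat"
  assumes "orthogonal_matrix Q"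
  shows "norm (Q ** A) = norm A"
  using assms by (simp add: norm_eq_sqrt_inner inner_matrix_mult_left matrix_mul_assoc orthogonal_matrix)

lemma norm_orthogonal_mult_right:
  fixes Q A :: "'d::finite sqmat"
  assumes "orthogonal_matrix Q"
  shows "norm (A ** Q) = norm A"
  using norm_orthogonal_mult_left[of "transpose Q" "transpose A"] assms
  by (simp add: norm_transpose flip: matrix_transpose_mul)

lemma norm_orthogonal_matrix:
  fixes Q :: "'d::finite sqmat"
  assumes "orthogonal_matrix Q"
  shows "norm Q = norm (mat 1 :: 'd sqmat)"
  using norm_orthogonal_mult_left[OF assms, of "mat 1"] by simp

text \<open>Each entry of the product pairs a row of \<open>A\<close> with a column of
  \<open>B\<close>. Cauchy-Schwarz bounds it, and the resulting double sum factors.\<close>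

lemma norm_matrix_mult_le:
  fixes A B :: "'d::finite sqmat"
  shows "norm (A ** B) \<le> norm A * norm B"
proof -
  have sq: "(norm A)\<^sup>2 = (\<Sum>i\<in>UNIV. (norm (A $ i))\<^sup>2)" for A :: "'d sqmat"
    by (simp add: power2_norm_eq_inner inner_vec_def)
  have sq': "(norm B)\<^sup>2 = (\<Sum>j\<in>UNIV. (norm (column j B))\<^sup>2)"
    using sq[of "transpose B"] by (simp add: norm_transpose row_def flip: row_transpose)
  have "(norm (A ** B))\<^sup>2 = (\<Sum>i\<in>UNIV. \<Sum>j\<in>UNIV. (inner (A $ i) (column j B))\<^sup>2)"
    unfolding power2_norm_eq_inner
    by (simp add: inner_vec_def matrix_matrix_mult_def column_def power2_eq_square)
  also have "\<dots> \<le> (\<Sum>i\<in>UNIV. \<Sum>j\<in>UNIV. (norm (A $ i))\<^sup>2 * (norm (column j B))\<^sup>2)"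
  proof (intro sum_mono)
    fix i j
    show "(inner (A $ i) (column j B))\<^sup>2 \<le> (norm (A $ i))\<^sup>2 * (norm (column j B))\<^sup>2"
      using Cauchy_Schwarz_ineq[of "A $ i" "column j B"] by (simp add: power2_norm_eq_inner)
  qed
  also have "\<dots> = (norm A * norm B)\<^sup>2"
    by (simp add: sq[of A] sq' power_mult_distrib sum_product)
  finally show ?thesis
    by (rule power2_le_imp_le) simp
qed

lemma abs_entry_le_norm:
  fixes A :: "'d::finite sqmat"
  shows "\<bar>A $ i $ j\<bar> \<le> norm A"
  by (rule order_trans[OF component_le_norm_cart Finite_Cartesian_Product.norm_nth_le])

text \<open>Gives the distributive and scaling laws used throughout, and the product rule for
  differentiating \<open>transpose Y ** B ** Y\<close>.\<close>

lemma bounded_bilinear_matrix_mult: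
  "bounded_bilinear ((**) :: 'd::finite sqmat \<Rightarrow> 'd sqmat \<Rightarrow> 'd sqmat)"
proof
  fix A B C :: "'d sqmat" and r :: real
  show "(A + B) ** C = A ** C + B ** C"
    by (simp add: matrix_matrix_mult_def vec_eq_iff sum.distrib distrib_right)
  show "A ** (B + C) = A ** B + A ** C" by (rule matrix_add_ldistrib)
  show "(r *\<^sub>R A) ** B = r *\<^sub>R (A ** B)" by (rule scalar_matrix_assoc[symmetric])
  show "A ** (r *\<^sub>R B) = r *\<^sub>R (A ** B)" by (simp only: matrix_scalar_ac scalar_matrix_assoc)
  show "\<exists>K. \<forall>(A :: 'd sqmat) (B :: 'd sqmat). norm (A ** B) \<le> norm A * norm B * K"
    by (intro exI[of _ 1] allI) (simp only: mult_1_right norm_matrix_mult_le)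
qed

lemmas matrix_mult_add_left = bounded_bilinear.add_left[OF bounded_bilinear_matrix_mult]
  and matrix_mult_add_right = bounded_bilinear.add_right[OF bounded_bilinear_matrix_mult]
  and matrix_mult_diff_right = bounded_bilinear.diff_right[OF bounded_bilinear_matrix_mult]
  and matrix_mult_scaleR_left = bounded_bilinear.scaleR_left[OF bounded_bilinear_matrix_mult]
  and matrix_mult_scaleR_right = bounded_bilinear.scaleR_right[OF bounded_bilinear_matrix_mult]

lemma bounded_linear_transpose: "bounded_linear (transpose :: 'd::finite sqmat \<Rightarrow> 'd sqmat)"
proof (rule bounded_linear_intro[where K = 1])
  fix A B :: "'d sqmat" and r :: real
  show "transpose (A + B) = transpose A + transpose B"
    by (simp add: transpose_def vec_eq_iff)
  show "transpose (r *\<^sub>R A) = r *\<^sub>R transpose A"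
    by (simp add: transpose_def vec_eq_iff)
  show "norm (transpose A) \<le> norm A * 1"
    by (simp add: norm_transpose)
qed

lemmas transpose_add = linear_add[OF bounded_linear.linear[OF bounded_linear_transpose]]
  and transpose_diff = linear_diff[OF bounded_linear.linear[OF bounded_linear_transpose]]
  and transpose_scaleR = linear_cmul[OF bounded_linear.linear[OF bounded_linear_transpose]]

text \<open>Turns an identity between Gram matrices into one between squared lengths of image
  vectors, which yields injectivity of \<open>U + V\<close> and expansion by
  \<open>R\<close>.\<close>

lemma inner_gram_matrix:
  fixes A :: "'d::finite sqmat"
  shows "inner x ((transpose A ** A) *v x) = inner (A *v x) (A *v x)"
proof -
  have "inner x ((transpose A ** A) *v x) = inner x ((A *v x) v* A)"
    by (simp only: matrix_vector_mul_assoc[symmetric] transpose_matrix_vector)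
  also have "\<dots> = inner ((A *v x) v* A) x" by (rule inner_commute)
  also have "\<dots> = inner (A *v x) (A *v x)" by (rule dot_lmul_matrix)
  finally show ?thesis .
qed

lemma matrix_mult_entry: "(A ** B) $ i $ j = (\<Sum>k\<in>UNIV. A $ i $ k * B $ k $ j)"
  by (simp add: matrix_matrix_mult_def)

subsection \<open>QR factorization and the retraction\<close>

text \<open>Gram-Schmidt in the order of the index type: \<open>z i\<close> is the part of column
  \<open>i\<close> orthogonal to the span of the earlier columns, and \<open>Q\<close> has the
  normalized \<open>z i\<close> as columns.\<close>

lemma QR_exists:
  fixes M :: "'d::{finite,wellorder} sqmat"
  assumes inj: "\<And>x. M *v x = 0 \<Longrightarrow> x = 0"
  obtains Q R where "orthogonal_matrix Q" "upper_triangular R" "\<And>i. 0 < R $ i $ i" "M = Q ** R"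
proof -
  define W where "W i = (\<lambda>j. column j M) ` {j. j < i}" for i
  have "\<exists>z. column i M - z \<in> span (W i) \<and> (\<forall>w\<in>span (W i). inner z w = 0)" for i
  proof -
    obtain y z where "y \<in> span (W i)" "\<And>w. w \<in> span (W i) \<Longrightarrow> orthogonal z w" "column i M = y + z"
      by (rule orthogonal_subspace_decomp_exists[of "W i" "column i M"]) blast
    then show ?thesis
      by (intro exI[of _ z]) (auto simp: orthogonal_def)
  qed
  then obtain z where z: "\<And>i. column i M - z i \<in> span (W i)"
    and perp: "\<And>i w. w \<in> span (W i) \<Longrightarrow> inner (z i) w = 0"
    by metis
  \<comment> \<open>Otherwise column \<open>i\<close> is \<open>M *v x\<close> with \<open>x\<close>
    supported on indices below \<open>i\<close>, so \<open>M\<close> kills the nonzero vector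
    \<open>x - axis i 1\<close>.\<close>
  have nz: "z i \<noteq> 0" for i
  proof
    assume "z i = 0"
    then have "column i M \<in> span (W i)" using z[of i] by simp
    also have "W i = (*v) M ` (\<lambda>j. axis j 1) ` {j. j < i}"
      by (simp add: W_def image_image matrix_vector_mult_basis)
    also have "span \<dots> = (*v) M ` span ((\<lambda>j. axis j 1) ` {j. j < i})"
      by (rule span_linear_image) simp
    finally obtain x where x: "x \<in> span ((\<lambda>j. axis j 1) ` {j. j < i})" "M *v x = column i M"
      by auto
    have "x $ i = 0"
      using x(1)
    proof (induction rule: span_induct_alt)
      case base
      then show ?case by simp
    next
      case (step c x y)
      then show ?case by (auto simp: axis_def split: if_splits)
    qed
    moreover have "M *v (x - axis i 1) = 0"
      using x(2) by (simp add: matrix_vector_mult_diff_distrib matrix_vector_mult_basis)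
    then have "x = axis i 1" using inj by fastforce
    ultimately show False by simp
  qed
  have col_in: "column j M \<in> span (W i)" if "j < i" for i j
    using that by (auto simp: W_def intro!: span_base)
  have z_in: "z j \<in> span (W i)" if "j < i" for i j
  proof -
    have "span (W j) \<subseteq> span (W i)"
      using that by (intro span_mono) (auto simp: W_def)
    then have "column j M - (column j M - z j) \<in> span (W i)"
      using z[of j] col_in[OF that] by (blast intro: span_diff)
    then show ?thesis by simp
  qed
  have orth: "inner (z i) (z j) = 0" if "i \<noteq> j" for i j
    using that perp[OF z_in] by (metis inner_commute linorder_neqE)
  define Q :: "'d sqmat" where "Q = (\<chi> k i. (z i /\<^sub>R norm (z i)) $ k)"
  define R where "R = transpose Q ** M"
  have colQ: "column i Q = z i /\<^sub>R norm (z i)" for i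
    by (simp add: Q_def column_def vec_eq_iff)
  have Q: "orthogonal_matrix Q"
    unfolding orthogonal_matrix_orthonormal_columns
    using nz orth by (auto simp: colQ orthogonal_def)
  have R: "R $ i $ j = inner (column i Q) (column j M)" for i j
    by (simp add: R_def matrix_mult_transpose_dot_column matrix_matrix_mult_def transpose_def
        inner_vec_def column_def)
  show ?thesis
  proof
    show "orthogonal_matrix Q" by fact
    show "upper_triangular R"
      unfolding upper_triangular_def using perp[OF col_in] by (simp add: R colQ)
    show "0 < R $ i $ i" for i
    proof -
      have "inner (z i) (column i M) = inner (z i) (z i)"
        using perp[OF z, of i] by (simp add: inner_diff_right)
      then show ?thesis using nz[of i] by (simp add: R colQ)
    qed
    show "M = Q ** R"
      using Q by (simp add: R_def matrix_mul_assoc orthogonal_matrix_def)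
  qed
qed

text \<open>The orthogonal matrix \<open>P = transpose Q' ** Q\<close> carries \<open>R\<close> to
  \<open>R'\<close>. By induction its columns are unit vectors: triangularity clears the entries
  below the diagonal, orthogonality to earlier columns those above, and positivity fixes the sign of
  the diagonal entry.\<close>

lemma QR_unique:
  fixes Q Q' R R' :: "'d::{finite,wellorder} sqmat"
  assumes Q: "orthogonal_matrix Q" "orthogonal_matrix Q'"
    and R: "upper_triangular R" "upper_triangular R'"
    and pos: "\<And>i. 0 < R $ i $ i" "\<And>i. 0 < R' $ i $ i"
    and eq: "Q ** R = Q' ** R'"
  shows "Q = Q'"
proof -
  define P where "P = transpose Q' ** Q"
  have orthP: "orthogonal_matrix P"
    unfolding P_def using Q by (intro orthogonal_matrix_mul) auto
  have PR: "P ** R = R'"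
    by (metis P_def Q(2) eq matrix_mul_assoc matrix_mul_lid orthogonal_matrix)
  have dot: "(\<Sum>k\<in>UNIV. P $ k $ i * P $ k $ j) = (if i = j then 1 else 0)" for i j
    using arg_cong[OF orthP[unfolded orthogonal_matrix], of "\<lambda>A. A $ i $ j"]
    by (simp add: matrix_mult_entry transpose_def mat_def)
  have col: "P $ i $ j = (if i = j then 1 else 0)" for i j
  proof (induction j arbitrary: i rule: less_induct)
    case (less j)
    have entry: "P $ i $ j * R $ j $ j = R' $ i $ j" if "j \<le> i" for i
    proof -
      have "R' $ i $ j = (\<Sum>k\<in>UNIV. P $ i $ k * R $ k $ j)"
        using PR by (auto simp flip: matrix_mult_entry)
      also have "\<dots> = (\<Sum>k\<in>UNIV. if k = j then P $ i $ j * R $ j $ j else 0)"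
      proof (intro sum.cong refl)
        fix k show "P $ i $ k * R $ k $ j = (if k = j then P $ i $ j * R $ j $ j else 0)"
          using less[of k i] R(1) that unfolding upper_triangular_def
          by (cases k j rule: linorder_cases) auto
      qed
      finally show ?thesis by simp
    qed
    have below: "P $ i $ j = 0" if "j < i" for i
      using entry[of i] that R(2) pos(1)[of j] unfolding upper_triangular_def by auto
    have above: "P $ i $ j = 0" if "i < j" for i
      using dot[of i j] that less[OF that] by (auto simp: if_distrib[of "\<lambda>x. x * _"] cong: if_cong)
    have off: "P $ i $ j = 0" if "i \<noteq> j" for i
      using above below that by (metis linorder_neqE)
    have "(\<Sum>k\<in>UNIV. P $ k $ j * P $ k $ j) = (\<Sum>k\<in>UNIV. if k = j then P $ j $ j * P $ j $ j else 0)"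
      using off by (intro sum.cong) auto
    then have "(P $ j $ j)\<^sup>2 = 1" using dot[of j j] by (simp add: power2_eq_square)
    moreover have "0 < P $ j $ j"
      using entry[of j] pos(1)[of j] pos(2)[of j] by (metis order_refl zero_less_mult_pos2)
    ultimately show ?case using off by (auto simp: power2_eq_1_iff)
  qed
  then have "P = mat 1" by (simp add: vec_eq_iff mat_def)
  moreover have "Q' ** P = Q"
    using Q(2) by (simp add: P_def matrix_mul_assoc orthogonal_matrix_def)
  ultimately show ?thesis by simp
qed

text \<open>Existence and uniqueness together discharge the definite description in
  \<open>QR_orth\<close>.\<close>

lemma QR_orth:
  fixes M :: "'d::{finite,wellorder} sqmat"
  assumes "\<And>x. M *v x = 0 \<Longrightarrow> x = 0"
  obtains R where "orthogonal_matrix (QR_orth M)" "upper_triangular R" "\<And>i. 0 < R $ i $ i"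
    "M = QR_orth M ** R"
proof -
  let ?P = "\<lambda>Q. orthogonal_matrix Q \<and> (\<exists>R. upper_triangular R \<and> (\<forall>i. 0 < R $ i $ i) \<and> M = Q ** R)"
  obtain Q R where "orthogonal_matrix Q" "upper_triangular R" "\<And>i. 0 < R $ i $ i" "M = Q ** R"
    using QR_exists[OF assms] by blast
  then have "?P Q" by blast
  moreover have "Q' = Q''" if "?P Q'" "?P Q''" for Q' Q''
    using that by (metis QR_unique)
  ultimately have "?P (QR_orth M)"
    unfolding QR_orth_def by (intro theI[of ?P]) blast+
  then show thesis using that by blast
qed

section \<open>Distance of the triangular factor from the identity\<close>

lemma upper_triangular_diag_ge_1:
  fixes R :: "'d::{finite,wellorder} sqmat"
  assumes R: "upper_triangular R" and pos: "\<And>i. 0 < R $ i $ i"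
    and expand: "\<And>x. norm x \<le> norm (R *v x)"
  shows "1 \<le> R $ i $ i"
proof - \<comment> \<open>The solution of \<open>R x = e\<^sub>i\<close> has \<open>x\<^sub>i = 1 / R\<^sub>i\<^sub>i\<close>.\<close>
  have "inj ((*v) R)"
  proof (rule injI)
    fix x y assume "R *v x = R *v y"
    then have "norm (x - y) \<le> 0"
      using expand[of "x - y"] by (simp add: matrix_vector_mult_diff_distrib)
    then show "x = y" by simp
  qed
  then have "surj ((*v) R)" by (simp add: linear_injective_imp_surjective)
  then obtain x where x: "R *v x = axis i 1" by (metis surjD)
  \<comment> \<open>With \<open>k\<close> the last index in the support of \<open>x\<close>, row
    \<open>k\<close> of \<open>R *v x\<close> reduces to its diagonal term, which is nonzero; this
    forces \<open>k = i\<close>.\<close>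
  define k where "k = Max {k. x $ k \<noteq> 0}"
  have "x \<noteq> 0" using x by (auto simp: axis_eq_0_iff)
  then have ne: "{k. x $ k \<noteq> 0} \<noteq> {}" by (auto simp: vec_eq_iff)
  have k: "x $ k \<noteq> 0" using Max_in[OF _ ne] by (simp add: k_def)
  have gt: "x $ l = 0" if "k < l" for l
    using Max_ge[of "{k. x $ k \<noteq> 0}" l] that by (fastforce simp: k_def[symmetric])
  have "(R *v x) $ k = (\<Sum>l\<in>UNIV. R $ k $ l * x $ l)"
    by (simp add: matrix_vector_mult_def)
  also have "\<dots> = (\<Sum>l\<in>UNIV. if l = k then R $ k $ k * x $ k else 0)"
  proof (intro sum.cong refl)
    fix l show "R $ k $ l * x $ l = (if l = k then R $ k $ k * x $ k else 0)"
      using gt R unfolding upper_triangular_def by (cases k l rule: linorder_cases) auto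
  qed
  finally have Rk: "(R *v x) $ k = R $ k $ k * x $ k" by simp
  then have "k = i" using k pos[of k] x by (auto simp: axis_def split: if_splits)
  then have one: "R $ i $ i * x $ i = 1" using Rk x by simp
  have "\<bar>x $ i\<bar> \<le> norm x" by (rule component_le_norm_cart)
  also have "\<dots> \<le> 1" using expand[of x] x by simp
  finally have "R $ i $ i * x $ i \<le> R $ i $ i * 1"
    using pos[of i] by (intro mult_left_mono) auto
  then show ?thesis using one by simp
qed

text \<open>The symmetrization keeps the entries above the diagonal, doubles the diagonal, and
  \<open>T\<close> vanishes below it. A Gram identity controls only \<open>T + transpose T\<close>;
  this recovers control of \<open>T\<close>.\<close>

lemma norm_upper_triangular_le_symmetrization:
  fixes T :: "'d::{finite,wellorder} sqmat"
  assumes "upper_triangular T"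
  shows "norm T \<le> norm (T + transpose T)"
proof (rule norm_le_componentwise_cart)
  fix i
  show "norm (T $ i) \<le> norm ((T + transpose T) $ i)"
  proof (rule norm_le_componentwise_cart)
    fix j
    show "norm (T $ i $ j) \<le> norm ((T + transpose T) $ i $ j)"
      using assms unfolding upper_triangular_def transpose_def
      by (cases i j rule: linorder_cases) auto
  qed
qed

lemma QR_factor_estimates:
  fixes R V :: "'d::{finite,wellorder} sqmat"
  assumes R: "upper_triangular R" and pos: "\<And>i. 0 < R $ i $ i"
    and gram: "transpose R ** R = mat 1 + transpose V ** V"
  shows "norm (R - mat 1) \<le> norm V" and "norm (R - mat 1) \<le> 2 * (norm V)\<^sup>2"
proof -
  have "norm x \<le> norm (R *v x)" for x
  proof -
    have "inner (R *v x) (R *v x) = inner x x + inner (V *v x) (V *v x)"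
      unfolding inner_gram_matrix[symmetric] gram
      by (simp add: matrix_vector_mult_add_rdistrib inner_add_right)
    then show ?thesis by (simp add: norm_le)
  qed
  from upper_triangular_diag_ge_1[OF R pos this] have diag: "1 \<le> R $ i $ i" for i .
  define T where "T = R - mat 1"
  have "inner R R = inner (mat 1) (transpose R ** R)"
    using inner_matrix_mult_left[of R "mat 1" R] by simp
  also have "\<dots> = inner (mat 1) (mat 1 :: 'd sqmat) + inner V V"
    using inner_matrix_mult_left[of V "mat 1" V] by (simp add: gram inner_add_right)
  finally have RR: "inner R R = inner (mat 1) (mat 1 :: 'd sqmat) + inner V V" .
  \<comment> \<open>With \<open>tr R \<ge> d\<close> this gives \<open>\<parallel>R - I\<parallel>\<^sup>2 = 2 d + \<parallel>V\<parallel>\<^sup>2 - 2 tr R \<le> \<parallel>V\<parallel>\<^sup>2\<close>.\<close>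
  have "inner (mat 1) (mat 1 :: 'd sqmat) \<le> inner R (mat 1)"
    unfolding inner_vec_def mat_def using diag by (auto intro!: sum_mono)
  then have "inner T T \<le> inner V V"
    using RR by (simp add: T_def inner_diff inner_commute)
  then show TV: "norm (R - mat 1) \<le> norm V" by (simp add: norm_le T_def)
  have "upper_triangular T"
    using R by (auto simp: T_def upper_triangular_def mat_def)
  then have "norm T \<le> norm (T + transpose T)" by (rule norm_upper_triangular_le_symmetrization)
  \<comment> \<open>Expanding the Gram identity with \<open>R = mat 1 + T\<close> isolates the part
    linear in \<open>T\<close>. The right side is quadratic, and the first estimate replaces the
    norm of \<open>T\<close> by that of \<open>V\<close>.\<close>
  also have "T + transpose T = transpose V ** V - transpose T ** T"
  proof -
    have R1: "R = mat 1 + T" by (simp add: T_def)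
    have "transpose R = mat 1 + transpose T"
      by (simp add: R1 transpose_add)
    then have "mat 1 + transpose V ** V = (mat 1 + transpose T) ** (mat 1 + T)"
      using gram R1 by simp
    then show ?thesis
      by (simp add: matrix_mult_add_left matrix_mult_add_right algebra_simps)
  qed
  also have "norm (transpose V ** V - transpose T ** T) \<le> norm V * norm V + norm T * norm T"
    by (rule order_trans[OF norm_triangle_ineq4])
      (metis add_mono norm_matrix_mult_le norm_transpose)
  also have "\<dots> \<le> norm V * norm V + norm V * norm V"
    using TV by (intro add_mono mult_mono) (auto simp: T_def)
  finally show "norm (R - mat 1) \<le> 2 * (norm V)\<^sup>2" by (simp add: T_def power2_eq_square)
qed

text \<open>The hypothesis \<open>skew\<close> is tangency of \<open>V\<close> at \<open>U\<close>.
  In the descent step the linear bound serves the quadratic remainder of the objective, and the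
  quadratic bound serves the pairing with the gradient.\<close>

lemma Retr_estimates:
  fixes U V :: "'d::{finite,wellorder} sqmat"
  assumes U: "orthogonal_matrix U" and skew: "transpose U ** V + transpose V ** U = 0"
  shows "orthogonal_matrix (Retr U V)"
    and "norm (Retr U V - U) \<le> 2 * norm V"
    and "norm (Retr U V - U - V) \<le> 2 * (norm V)\<^sup>2"
proof -
  let ?M = "U + V"
  have gram: "transpose ?M ** ?M = mat 1 + transpose V ** V"
  proof -
    have "transpose ?M ** ?M =
        transpose U ** U + (transpose U ** V + transpose V ** U) + transpose V ** V"
      by (simp add: transpose_add matrix_mult_add_left matrix_mult_add_right add_ac)
    then show ?thesis using U by (simp only: skew orthogonal_matrix add_0_right)
  qed
  have inj: "x = 0" if "?M *v x = 0" for x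
  proof -
    have "inner (?M *v x) (?M *v x) = inner x x + inner (V *v x) (V *v x)"
      unfolding inner_gram_matrix[symmetric] gram
      by (simp add: matrix_vector_mult_add_rdistrib inner_add_right)
    then have "inner x x + inner (V *v x) (V *v x) = 0" by (simp only: that inner_zero_left)
    then have "inner x x = 0"
      using inner_ge_zero[of x] inner_ge_zero[of "V *v x"] by linarith
    then show ?thesis by (simp only: inner_eq_zero_iff)
  qed
  define Q where "Q = QR_orth ?M"
  obtain R where Q: "orthogonal_matrix Q" and R: "upper_triangular R" "\<And>i. 0 < R $ i $ i"
    and M: "?M = Q ** R"
    unfolding Q_def using QR_orth[of ?M] inj by blast
  have gramR: "transpose R ** R = mat 1 + transpose V ** V"
  proof -
    have "transpose ?M ** ?M = transpose R ** (transpose Q ** Q) ** R"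
      unfolding M by (simp only: matrix_transpose_mul matrix_mul_assoc)
    then show ?thesis using Q gram by (simp add: orthogonal_matrix)
  qed
  have RQ: "Retr U V = Q" by (simp add: Retr_def Q_def)
  show "orthogonal_matrix (Retr U V)" using Q by (simp add: RQ)
  \<comment> \<open>Multiplication by \<open>Q\<close> preserves the norm, so the retraction error
    is exactly the distance of \<open>R\<close> from the identity.\<close>
  have "?M - Q = Q ** (R - mat 1)"
    unfolding M using matrix_add_ldistrib[of Q "R - mat 1" "mat 1"] by simp
  then have nrm: "norm (Q - U - V) = norm (R - mat 1)"
    using norm_orthogonal_mult_left[OF Q, of "R - mat 1"] norm_minus_commute[of ?M Q]
    by (simp only: diff_diff_add)
  show "norm (Retr U V - U - V) \<le> 2 * (norm V)\<^sup>2"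
    using QR_factor_estimates(2)[OF R gramR] by (simp add: RQ nrm)
  have "norm (Q - U) \<le> norm (Q - U - V) + norm V"
    using norm_triangle_ineq[of "Q - U - V" V] by simp
  then show "norm (Retr U V - U) \<le> 2 * norm V"
    using QR_factor_estimates(1)[OF R gramR] by (simp add: RQ nrm)
qed

subsection \<open>The Riemannian gradient\<close>

text \<open>Since \<open>transpose U ** U = mat 1\<close>, the matrix
  \<open>transpose U ** rgrad F U\<close> is the skew-symmetric part of
  \<open>transpose U ** egrad F U\<close>.\<close>

lemma rgrad_tangent:
  fixes U :: "'d::finite sqmat"
  assumes U: "orthogonal_matrix U"
  shows "transpose U ** rgrad F U + transpose (rgrad F U) ** U = 0"
proof -
  let ?G = "egrad F U"
  have "U ** transpose ?G ** U = U ** (transpose ?G ** U)" by (simp add: matrix_mul_assoc)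
  then have "transpose U ** rgrad F U =
      (1/2) *\<^sub>R (transpose U ** ?G) - (1/2) *\<^sub>R ((transpose U ** U) ** (transpose ?G ** U))"
    by (simp add: rgrad_def matrix_mult_diff_right matrix_mult_scaleR_right matrix_mul_assoc)
  then have S: "transpose U ** rgrad F U =
      (1/2) *\<^sub>R (transpose U ** ?G) - (1/2) *\<^sub>R (transpose ?G ** U)"
    using U by (simp add: orthogonal_matrix)
  have "transpose (rgrad F U) ** U = transpose (transpose U ** rgrad F U)"
    by (simp add: matrix_transpose_mul)
  then show ?thesis
    by (simp add: S transpose_diff transpose_scaleR matrix_transpose_mul)
qed

text \<open>The map sending \<open>G\<close> to \<open>U ** transpose G ** U\<close> preserves the
  norm, and for vectors \<open>G\<close>, \<open>W\<close> of equal norm the pairing of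
  \<open>G\<close> with \<open>(G - W) / 2\<close> is the squared norm of
  \<open>(G - W) / 2\<close>.\<close>

lemma inner_egrad_rgrad:
  fixes U :: "'d::finite sqmat"
  assumes U: "orthogonal_matrix U"
  shows "inner (egrad F U) (rgrad F U) = (norm (rgrad F U))\<^sup>2"
proof -
  let ?G = "egrad F U" and ?W = "U ** transpose (egrad F U) ** U"
  have "norm ?W = norm ?G"
    using U by (simp add: norm_orthogonal_mult_right norm_orthogonal_mult_left norm_transpose)
  then have "inner ?W ?W = inner ?G ?G" by (simp add: norm_eq)
  then show ?thesis
    by (simp add: rgrad_def power2_norm_eq_inner inner_diff inner_commute algebra_simps)
qed

subsection \<open>Smoothness of the objective\<close>

text \<open>Concavity of the square root: multiplied out, the claim is nonnegativity of
  \<open>(sqrt a - sqrt b)\<^sup>2\<close>.\<close>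

lemma sqrt_le_tangent:
  assumes "0 < a" "0 \<le> b"
  shows "sqrt b \<le> sqrt a + (b - a) / (2 * sqrt a)"
proof -
  have "0 \<le> (sqrt a - sqrt b)\<^sup>2" by simp
  moreover have "(sqrt b - sqrt a) * (2 * sqrt a) = (sqrt b)\<^sup>2 - (sqrt a)\<^sup>2 - (sqrt a - sqrt b)\<^sup>2"
    by algebra
  ultimately have "(sqrt b - sqrt a) * (2 * sqrt a) \<le> b - a"
    using assms by simp
  then have "sqrt b - sqrt a \<le> (b - a) / (2 * sqrt a)"
    using assms by (simp add: pos_le_divide_eq)
  then show ?thesis by simp
qed

text \<open>The Riesz representative \<open>adjoint F' 1\<close> of the derivative is a gradient,
  and uniqueness of derivatives makes it the only one, so the description in \<open>egrad\<close> is
  met.\<close>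

lemma inner_egrad:
  assumes "(F has_derivative F') (at X)"
  shows "inner (egrad F X) H = F' H"
proof -
  define G where "G = adjoint F' 1"
  have G: "F' = (\<lambda>H. inner H G)"
    using adjoint_works[OF has_derivative_linear[OF assms], of _ 1] by (simp add: G_def fun_eq_iff)
  have "egrad F X = G"
    unfolding egrad_def
  proof (rule the_equality)
    show "GDERIV F X :> G" using assms by (simp add: gderiv_def G)
  next
    fix G' assume "GDERIV F X :> G'"
    then have "(\<lambda>H. inner H G') = (\<lambda>H. inner H G)"
      using has_derivative_unique[OF _ assms] by (simp add: gderiv_def G)
    then show "G' = G" by (metis vector_eq_ldot)
  qed
  then show ?thesis by (simp add: G inner_commute)
qed

section \<open>Quadratic matrix entries and their squares\<close>

definition quad :: "'d::finite sqmat \<Rightarrow> 'd \<Rightarrow> 'd \<Rightarrow> 'd sqmat \<Rightarrow> real" where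
  "quad B i j X = (transpose X ** B ** X) $ i $ j"

definition quad_deriv :: "'d::finite sqmat \<Rightarrow> 'd \<Rightarrow> 'd \<Rightarrow> 'd sqmat \<Rightarrow> 'd sqmat \<Rightarrow> real" where
  "quad_deriv B i j X H = (transpose X ** B ** H + transpose H ** B ** X) $ i $ j"

lemma quad_has_derivative: "(quad B i j has_derivative quad_deriv B i j X) (at X)"
proof -
  have "((\<lambda>Y. transpose Y ** B ** Y) has_derivative
      (\<lambda>H. transpose X ** B ** H + transpose H ** B ** X)) (at X)"
    by (rule bounded_bilinear.FDERIV[OF bounded_bilinear_matrix_mult _ has_derivative_ident]
        bounded_linear.has_derivative[OF bounded_bilinear.bounded_linear_left[OF bounded_bilinear_matrix_mult]]
        bounded_linear_imp_has_derivative bounded_linear_transpose)+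
  from bounded_linear.has_derivative[OF bounded_linear_vec_nth this, of i]
  have "((\<lambda>Y. (transpose Y ** B ** Y) $ i) has_derivative
      (\<lambda>H. (transpose X ** B ** H + transpose H ** B ** X) $ i)) (at X)" .
  from bounded_linear.has_derivative[OF bounded_linear_vec_nth this, of j]
  show ?thesis by (simp only: quad_def[abs_def] quad_deriv_def[abs_def])
qed

lemma norm_triple_product_le:
  fixes X B Y :: "'d::finite sqmat"
  shows "norm (transpose X ** B ** Y) \<le> norm X * norm B * norm Y"
proof -
  have "norm (transpose X ** B) * norm Y \<le> norm X * norm B * norm Y"
    using norm_matrix_mult_le[of "transpose X" B] by (intro mult_right_mono) (simp_all add: norm_transpose)
  then show ?thesis by (rule order_trans[OF norm_matrix_mult_le])
qed

lemma abs_quad_le: "\<bar>quad B i j X\<bar> \<le> norm B * (norm X)\<^sup>2"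
  using order_trans[OF abs_entry_le_norm norm_triple_product_le, of X B X i j]
  by (simp add: quad_def power2_eq_square mult_ac)

text \<open>Two matrices \<open>X\<close>, \<open>Y\<close> are allowed so that one bound covers
  both the derivative (\<open>Y = X\<close>) and the exact increment
  (\<open>Y = X + H\<close>).\<close>

lemma abs_sum_triple_products_le:
  fixes X Y H B :: "'d::finite sqmat"
  shows "\<bar>(transpose X ** B ** H + transpose H ** B ** Y) $ i $ j\<bar>
    \<le> norm B * (norm X + norm Y) * norm H"
proof -
  have "\<bar>(transpose X ** B ** H + transpose H ** B ** Y) $ i $ j\<bar>
      \<le> norm X * norm B * norm H + norm H * norm B * norm Y"
    by (rule order_trans[OF abs_entry_le_norm norm_triangle_mono[OF norm_triple_product_le norm_triple_product_le]])
  then show ?thesis by (simp add: algebra_simps)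
qed

lemma quad_square_expansion:
  fixes B X Y :: "'d::finite sqmat"
  assumes X: "norm X = c" and Y: "norm Y = c"
  shows "(quad B i j Y)\<^sup>2 - (quad B i j X)\<^sup>2
    \<le> 2 * quad B i j X * quad_deriv B i j X (Y - X) + 6 * (c * norm B)\<^sup>2 * (norm (Y - X))\<^sup>2"
proof -
  define H where "H = Y - X"
  define a where "a = quad B i j X"
  define b where "b = quad_deriv B i j X H"
  define k where "k = quad B i j H"
  have Y_eq: "Y = X + H" by (simp add: H_def)
  have q: "quad B i j Y = a + (b + k)"
    by (simp add: Y_eq a_def b_def k_def quad_def quad_deriv_def transpose_add
        matrix_mult_add_left matrix_mult_add_right)
  \<comment> \<open>Keeping the linear and quadratic parts together bounds the increment linearly in
    \<open>H\<close> through the norm of \<open>Y\<close>, so its square stays of second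
    order.\<close>
  have "b + k = (transpose X ** B ** H + transpose H ** B ** Y) $ i $ j"
    by (simp add: Y_eq b_def k_def quad_def quad_deriv_def transpose_add
        matrix_mult_add_left matrix_mult_add_right)
  then have "\<bar>b + k\<bar> \<le> norm B * (c + c) * norm H"
    using abs_sum_triple_products_le[of X B H Y i j] X Y by simp
  then have "\<bar>b + k\<bar>\<^sup>2 \<le> (norm B * (c + c) * norm H)\<^sup>2"
    by (rule power_mono) simp
  then have 1: "(b + k)\<^sup>2 \<le> 4 * ((c * norm B)\<^sup>2 * (norm H)\<^sup>2)"
    by (simp add: power2_eq_square algebra_simps)
  have "\<bar>a\<bar> * \<bar>k\<bar> \<le> (norm B * c\<^sup>2) * (norm B * (norm H)\<^sup>2)"
    using abs_quad_le[of B i j X] abs_quad_le[of B i j H] X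
    by (intro mult_mono) (auto simp: a_def k_def)
  then have 2: "a * k \<le> (c * norm B)\<^sup>2 * (norm H)\<^sup>2"
    using abs_ge_self[of "a * k"] by (simp add: abs_mult power2_eq_square mult_ac)
  \<comment> \<open>The constant 6 is 2 from the term \<open>2 * (a * k)\<close> plus 4 from
    \<open>(b + k)\<^sup>2\<close>.\<close>
  have "(quad B i j Y)\<^sup>2 - a\<^sup>2 = 2 * a * b + (2 * (a * k) + (b + k)\<^sup>2)"
    unfolding q by (simp add: power2_eq_square algebra_simps)
  also have "\<dots> \<le> 2 * a * b + 6 * ((c * norm B)\<^sup>2 * (norm H)\<^sup>2)"
    using 1 2 by linarith
  finally show ?thesis by (simp add: a_def b_def H_def mult.assoc)
qed

definition mean_sq :: "nat \<Rightarrow> (nat \<Rightarrow> 'd::finite sqmat) \<Rightarrow> real \<Rightarrow> 'd \<Rightarrow> 'd \<Rightarrow> 'd sqmat \<Rightarrow> real" where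
  "mean_sq N B \<epsilon> i j X = (1 / real N) * (\<Sum>n=1..N. (quad (B n) i j X)\<^sup>2) + \<epsilon>"

definition mean_sq_deriv ::
  "nat \<Rightarrow> (nat \<Rightarrow> 'd::finite sqmat) \<Rightarrow> 'd \<Rightarrow> 'd \<Rightarrow> 'd sqmat \<Rightarrow> 'd sqmat \<Rightarrow> real" where
  "mean_sq_deriv N B i j X H =
    (1 / real N) * (\<Sum>n=1..N. 2 * quad (B n) i j X * quad_deriv (B n) i j X H)"

definition ell_deriv ::
  "nat \<Rightarrow> (nat \<Rightarrow> 'd::finite sqmat) \<Rightarrow> real \<Rightarrow> 'd sqmat \<Rightarrow> 'd sqmat \<Rightarrow> real" where
  "ell_deriv N B \<epsilon> X H = (\<Sum>i\<in>UNIV. \<Sum>j\<in>UNIV - {i}.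
     mean_sq_deriv N B i j X H / (2 * sqrt (mean_sq N B \<epsilon> i j X)))"

lemma ell_eq: "ell N B \<epsilon> X = (\<Sum>i\<in>UNIV. \<Sum>j\<in>UNIV - {i}. sqrt (mean_sq N B \<epsilon> i j X))"
  by (simp add: ell_def mean_sq_def quad_def)

lemma mean_sq_ge: "\<epsilon> \<le> mean_sq N B \<epsilon> i j X"
  by (simp add: mean_sq_def sum_nonneg)

lemma mean_sq_has_derivative:
  "(mean_sq N B \<epsilon> i j has_derivative mean_sq_deriv N B i j X) (at X)"
proof -
  have "((\<lambda>Y. (quad (B n) i j Y)\<^sup>2) has_derivative
      (\<lambda>H. 2 * quad (B n) i j X * quad_deriv (B n) i j X H)) (at X)" for n
    by (rule has_derivative_eq_rhs[OF has_derivative_power[OF quad_has_derivative]]) (simp add: mult_ac)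
  from has_derivative_add[OF has_derivative_mult_right[OF has_derivative_sum[OF this]]
      has_derivative_const]
  show ?thesis
    unfolding mean_sq_def[abs_def] mean_sq_deriv_def[abs_def] add_0_right .
qed

lemma ell_has_derivative:
  assumes "0 < \<epsilon>"
  shows "(ell N B \<epsilon> has_derivative ell_deriv N B \<epsilon> X) (at X)"
proof -
  have pos: "0 < mean_sq N B \<epsilon> i j X" for i j
    using assms mean_sq_ge[of \<epsilon> N B i j X] by linarith
  have "((\<lambda>Y. \<Sum>i\<in>UNIV. \<Sum>j\<in>UNIV - {i}. sqrt (mean_sq N B \<epsilon> i j Y)) has_derivative
    (\<lambda>H. \<Sum>i\<in>UNIV. \<Sum>j\<in>UNIV - {i}. mean_sq_deriv N B i j X H * (inverse (sqrt (mean_sq N B \<epsilon> i j X)) / 2))) (at X)"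
  proof (intro has_derivative_sum)
    fix i j
    show "((\<lambda>Y. sqrt (mean_sq N B \<epsilon> i j Y)) has_derivative
      (\<lambda>H. mean_sq_deriv N B i j X H * (inverse (sqrt (mean_sq N B \<epsilon> i j X)) / 2))) (at X)"
      by (rule DERIV_compose_FDERIV[OF DERIV_real_sqrt[OF pos] mean_sq_has_derivative])
  qed
  then show ?thesis
    by (simp add: ell_eq[abs_def] ell_deriv_def[abs_def] field_simps)
qed

text \<open>The tangent bound for the square root and the expansion of squared entries compare
  \<open>X\<close> and \<open>Y\<close> directly, with no path between them; equality of norms is
  all that is used of orthogonality.\<close>

lemma ell_upper_bound:
  fixes B :: "nat \<Rightarrow> 'd::finite sqmat"
  assumes \<epsilon>: "0 < \<epsilon>"
  obtains C where "0 \<le> C" and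
    "\<And>X Y. norm X = c \<Longrightarrow> norm Y = c \<Longrightarrow>
      ell N B \<epsilon> Y \<le> ell N B \<epsilon> X + inner (egrad (ell N B \<epsilon>) X) (Y - X) + C * (norm (Y - X))\<^sup>2"
proof
  \<comment> \<open>\<open>M\<close> averages the remainder constants of
    \<open>quad_square_expansion\<close>; \<open>C\<close> divides by the slope denominator at the
    smallest radicand \<open>\<epsilon>\<close> and sums over off-diagonal pairs.\<close>
  define M where "M = (1 / real N) * (\<Sum>n=1..N. 6 * (c * norm (B n))\<^sup>2)"
  define C where "C = (\<Sum>i\<in>(UNIV :: 'd set). \<Sum>j\<in>UNIV - {i}. M / (2 * sqrt \<epsilon>))"
  have M: "0 \<le> M" by (simp add: M_def sum_nonneg)
  show "0 \<le> C" using M \<epsilon> by (auto simp: C_def intro!: sum_nonneg)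
  fix X Y :: "'d sqmat" assume XY: "norm X = c" "norm Y = c"
  let ?h = "(norm (Y - X))\<^sup>2"
  have "sqrt (mean_sq N B \<epsilon> i j Y) \<le> sqrt (mean_sq N B \<epsilon> i j X)
      + mean_sq_deriv N B i j X (Y - X) / (2 * sqrt (mean_sq N B \<epsilon> i j X))
      + M / (2 * sqrt \<epsilon>) * ?h" for i j
  proof -
    let ?p = "mean_sq N B \<epsilon> i j"
    have pX: "0 < ?p X" and pY: "0 \<le> ?p Y"
      using \<epsilon> mean_sq_ge[of \<epsilon> N B i j X] mean_sq_ge[of \<epsilon> N B i j Y] by linarith+
    have "?p Y - ?p X = (1 / real N) * (\<Sum>n=1..N. (quad (B n) i j Y)\<^sup>2 - (quad (B n) i j X)\<^sup>2)"
      by (simp add: mean_sq_def sum_subtractf diff_divide_distrib)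
    also have "\<dots> \<le> (1 / real N) * (\<Sum>n=1..N. 2 * quad (B n) i j X * quad_deriv (B n) i j X (Y - X)
        + 6 * (c * norm (B n))\<^sup>2 * ?h)"
      by (intro mult_left_mono sum_mono quad_square_expansion XY) simp
    also have "\<dots> = mean_sq_deriv N B i j X (Y - X) + M * ?h"
      by (simp only: sum.distrib distrib_left mean_sq_deriv_def M_def sum_distrib_right mult.assoc)
    finally have "(?p Y - ?p X) / (2 * sqrt (?p X))
        \<le> (mean_sq_deriv N B i j X (Y - X) + M * ?h) / (2 * sqrt (?p X))"
      using pX by (intro divide_right_mono) auto
    moreover have "M * ?h / (2 * sqrt (?p X)) \<le> M * ?h / (2 * sqrt \<epsilon>)"
      using \<epsilon> M mean_sq_ge[of \<epsilon> N B i j X] by (intro divide_left_mono) auto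
    ultimately show ?thesis
      using sqrt_le_tangent[OF pX pY] by (simp add: add_divide_distrib)
  qed
  then have "ell N B \<epsilon> Y \<le> (\<Sum>i\<in>UNIV. \<Sum>j\<in>UNIV - {i}. sqrt (mean_sq N B \<epsilon> i j X)
      + mean_sq_deriv N B i j X (Y - X) / (2 * sqrt (mean_sq N B \<epsilon> i j X))
      + M / (2 * sqrt \<epsilon>) * ?h)"
    unfolding ell_eq by (intro sum_mono)
  also have "\<dots> = ell N B \<epsilon> X + ell_deriv N B \<epsilon> X (Y - X) + C * ?h"
    by (simp only: sum.distrib ell_eq ell_deriv_def C_def sum_distrib_right)
  finally show "ell N B \<epsilon> Y \<le> ell N B \<epsilon> X + inner (egrad (ell N B \<epsilon>) X) (Y - X) + C * ?h"
    by (simp only: inner_egrad[OF ell_has_derivative[OF \<epsilon>]])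
qed

text \<open>Evaluating the derivative at the gradient \<open>G\<close> itself gives the squared norm
  of \<open>G\<close>, while termwise estimates give at most \<open>K * norm G\<close>; then cancel
  one factor.\<close>

lemma egrad_ell_bounded:
  fixes B :: "nat \<Rightarrow> 'd::finite sqmat"
  assumes \<epsilon>: "0 < \<epsilon>"
  obtains K where "0 \<le> K" and "\<And>X. norm X = c \<Longrightarrow> norm (egrad (ell N B \<epsilon>) X) \<le> K"
proof
  \<comment> \<open>The absolute values make \<open>M\<close> nonnegative for every real
    \<open>c\<close>, before any \<open>X\<close> of norm \<open>c\<close> is at hand.\<close>
  define M where "M = (1 / real N) * (\<Sum>n=1..N. 2 * (norm (B n) * c\<^sup>2) * (norm (B n) * (\<bar>c\<bar> + \<bar>c\<bar>)))"
  define K where "K = (\<Sum>i\<in>(UNIV :: 'd set). \<Sum>j\<in>UNIV - {i}. M / (2 * sqrt \<epsilon>))"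
  have M: "0 \<le> M" by (simp add: M_def sum_nonneg)
  show "0 \<le> K" using M \<epsilon> by (auto simp: K_def intro!: sum_nonneg)
  fix X :: "'d sqmat" assume X: "norm X = c"
  define G where "G = egrad (ell N B \<epsilon>) X"
  have c: "0 \<le> c" using X by auto
  have "mean_sq_deriv N B i j X G / (2 * sqrt (mean_sq N B \<epsilon> i j X)) \<le> M / (2 * sqrt \<epsilon>) * norm G" for i j
  proof -
    have "mean_sq_deriv N B i j X G
        \<le> (1 / real N) * (\<Sum>n=1..N. 2 * (norm (B n) * c\<^sup>2) * (norm (B n) * (\<bar>c\<bar> + \<bar>c\<bar>) * norm G))"
      unfolding mean_sq_deriv_def
    proof (intro mult_left_mono sum_mono)
      fix n
      have "2 * \<bar>quad (B n) i j X\<bar> * \<bar>quad_deriv (B n) i j X G\<bar>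
          \<le> 2 * (norm (B n) * c\<^sup>2) * (norm (B n) * (\<bar>c\<bar> + \<bar>c\<bar>) * norm G)"
        using abs_quad_le[of "B n" i j X] abs_sum_triple_products_le[of X "B n" G X i j] X c
        by (intro mult_mono) (auto simp: quad_deriv_def)
      then show "2 * quad (B n) i j X * quad_deriv (B n) i j X G
          \<le> 2 * (norm (B n) * c\<^sup>2) * (norm (B n) * (\<bar>c\<bar> + \<bar>c\<bar>) * norm G)"
        using abs_ge_self[of "2 * quad (B n) i j X * quad_deriv (B n) i j X G"]
        by (simp only: abs_mult abs_numeral)
    qed simp
    also have "\<dots> = M * norm G"
      by (simp only: M_def sum_distrib_right mult.assoc)
    finally have "mean_sq_deriv N B i j X G / (2 * sqrt (mean_sq N B \<epsilon> i j X))
        \<le> M * norm G / (2 * sqrt (mean_sq N B \<epsilon> i j X))"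
      using \<epsilon> mean_sq_ge[of \<epsilon> N B i j X] by (intro divide_right_mono) auto
    also have "\<dots> \<le> M * norm G / (2 * sqrt \<epsilon>)"
      using \<epsilon> M mean_sq_ge[of \<epsilon> N B i j X] by (intro divide_left_mono) auto
    finally show ?thesis by simp
  qed
  then have "ell_deriv N B \<epsilon> X G \<le> (\<Sum>i\<in>(UNIV :: 'd set). \<Sum>j\<in>UNIV - {i}. M / (2 * sqrt \<epsilon>) * norm G)"
    unfolding ell_deriv_def by (intro sum_mono)
  also have "\<dots> = K * norm G" by (simp only: K_def sum_distrib_right)
  also have "ell_deriv N B \<epsilon> X G = norm G * norm G"
    using inner_egrad[OF ell_has_derivative[OF \<epsilon>], of N B X G]
    by (simp add: G_def flip: power2_norm_eq_inner power2_eq_square)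
  finally have "norm G * norm G \<le> K * norm G" .
  then show "norm G \<le> K"
    using \<open>0 \<le> K\<close> by (cases "norm G = 0") auto
qed

subsection \<open>Descent and convergence\<close>

text \<open>The constant \<open>2 * K + 4 * C\<close> collects \<open>2 * K\<close> from the
  second-order retraction error paired with the gradient and \<open>4 * C\<close> from the squared
  bound \<open>2 * norm V\<close>.\<close>

lemma rgrad_descent_step:
  fixes F :: "'d::{finite,wellorder} sqmat \<Rightarrow> real"
  assumes upper: "\<And>X Y. orthogonal_matrix X \<Longrightarrow> orthogonal_matrix Y \<Longrightarrow>
      F Y \<le> F X + inner (egrad F X) (Y - X) + C * (norm (Y - X))\<^sup>2"
    and bound: "\<And>X. orthogonal_matrix X \<Longrightarrow> norm (egrad F X) \<le> K"
    and C: "0 \<le> C" and U: "orthogonal_matrix U"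
    and \<nu>: "0 < \<nu>" "\<nu> * (2 * (2 * K + 4 * C)) \<le> 1"
  shows "orthogonal_matrix (Retr U (- (\<nu> *\<^sub>R rgrad F U)))"
    and "F (Retr U (- (\<nu> *\<^sub>R rgrad F U))) - F U \<le> - (\<nu> / 2) * (norm (rgrad F U))\<^sup>2"
proof -
  define g where "g = rgrad F U"
  define V where "V = - (\<nu> *\<^sub>R g)"
  define Q where "Q = Retr U V"
  have V: "V = (- \<nu>) *\<^sub>R g" by (simp add: V_def)
  have "transpose U ** V + transpose V ** U = (- \<nu>) *\<^sub>R (transpose U ** g + transpose g ** U)"
    by (simp only: V transpose_scaleR matrix_mult_scaleR_left matrix_mult_scaleR_right scaleR_add_right)
  then have skew: "transpose U ** V + transpose V ** U = 0"
    using rgrad_tangent[OF U, of F] by (simp add: g_def)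
  note est = Retr_estimates[OF U skew, folded Q_def]
  show "orthogonal_matrix (Retr U (- (\<nu> *\<^sub>R rgrad F U)))"
    using est(1) by (simp add: Q_def V_def g_def)
  have "(norm (Q - U))\<^sup>2 \<le> (2 * norm V)\<^sup>2"
    by (intro power_mono est) simp
  then have 1: "C * (norm (Q - U))\<^sup>2 \<le> 4 * C * (norm V)\<^sup>2"
    using mult_left_mono[OF _ C] by (fastforce simp: power_mult_distrib mult_ac)
  have "inner (egrad F U) (Q - U) = inner (egrad F U) V + inner (egrad F U) (Q - U - V)"
    by (simp flip: inner_add_right)
  also have "inner (egrad F U) (Q - U - V) \<le> K * (2 * (norm V)\<^sup>2)"
  proof (rule order_trans[OF norm_cauchy_schwarz mult_mono[OF bound[OF U] est(3)]])
    show "0 \<le> K" using bound[OF U] norm_ge_zero[of "egrad F U"] by linarith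
  qed simp
  also have "inner (egrad F U) V = - \<nu> * (norm g)\<^sup>2"
    using inner_egrad_rgrad[OF U, of F] by (simp add: V g_def)
  finally have 2: "inner (egrad F U) (Q - U) \<le> - \<nu> * (norm g)\<^sup>2 + K * (2 * (norm V)\<^sup>2)" by simp
  \<comment> \<open>The step size restriction makes the second-order terms cost at most half of the
    first-order gain \<open>\<nu> * (norm g)\<^sup>2\<close>.\<close>
  have "\<nu> * (2 * (2 * K + 4 * C)) * (\<nu> * (norm g)\<^sup>2) \<le> 1 * (\<nu> * (norm g)\<^sup>2)"
    using \<nu> by (intro mult_right_mono) auto
  then have 3: "(2 * K + 4 * C) * (norm V)\<^sup>2 \<le> \<nu> / 2 * (norm g)\<^sup>2"
    by (simp add: V power2_eq_square algebra_simps)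
  have "F Q - F U \<le> - (\<nu> / 2) * (norm g)\<^sup>2"
    using upper[OF U est(1)] 1 2 3 by (simp add: algebra_simps)
  then show "F (Retr U (- (\<nu> *\<^sub>R rgrad F U))) - F U \<le> - (\<nu> / 2) * (norm (rgrad F U))\<^sup>2"
    by (simp add: Q_def V_def g_def)
qed

text \<open>A decreasing sequence bounded below converges, so its successive differences tend to 0;
  divided by \<open>c\<close> they dominate the squared norms of \<open>g\<close>.\<close>

lemma sufficient_decrease_convergence:
  fixes a :: "nat \<Rightarrow> real" and g :: "nat \<Rightarrow> 'a::real_normed_vector"
  assumes "0 < c" and lower: "\<And>r. 0 \<le> a r"
    and decrease: "\<And>r. a (Suc r) - a r \<le> - c * (norm (g r))\<^sup>2"
  shows "convergent a" and "g \<longlonglongrightarrow> 0"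
proof -
  have "decseq a"
  proof (rule decseq_SucI)
    fix r
    have "0 \<le> c * (norm (g r))\<^sup>2" using \<open>0 < c\<close> by simp
    then show "a (Suc r) \<le> a r" using decrease[of r] by simp
  qed
  then obtain l where l: "a \<longlonglongrightarrow> l"
    using decseq_convergent[of a 0] lower by blast
  then show "convergent a" by (rule convergentI)
  have "(\<lambda>r. (a r - a (Suc r)) / c) \<longlonglongrightarrow> (l - l) / c"
    using \<open>0 < c\<close> by (intro tendsto_intros l LIMSEQ_Suc) auto
  then have lim: "(\<lambda>r. (a r - a (Suc r)) / c) \<longlonglongrightarrow> 0" by simp
  have "(norm (g r))\<^sup>2 \<le> (a r - a (Suc r)) / c" for r
    using decrease[of r] \<open>0 < c\<close> by (simp add: field_simps)
  then have "(\<lambda>r. (norm (g r))\<^sup>2) \<longlonglongrightarrow> 0"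
    by (intro tendsto_sandwich[OF _ _ tendsto_const lim]) auto
  then have "(\<lambda>r. sqrt ((norm (g r))\<^sup>2)) \<longlonglongrightarrow> sqrt 0" by (rule tendsto_real_sqrt)
  then show "g \<longlonglongrightarrow> 0" by (simp add: tendsto_norm_zero_iff)
qed

text \<open>The decrease carries the factor \<open>\<nu> / 2\<close>, which is
  \<open>1 / (2 * L)\<close> at the largest step. For fixed \<open>L\<close> the factor
  \<open>1 / (2 * L)\<close> cannot serve all smaller steps: if the gradient at \<open>U 0\<close>
  is nonzero, the first decrease tends to 0 with \<open>\<nu>\<close>.\<close>

theorem theorem4p2:
  fixes B :: "nat \<Rightarrow> 'd::{finite,wellorder} sqmat" and N :: nat and \<epsilon> :: real
  assumes "CARD('d) \<ge> 2" and "N \<ge> 1" and "\<epsilon> > 0"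
    and "\<And>n. n \<in> {1..N} \<Longrightarrow> transpose (B n) = B n"
    and "\<And>n i. n \<in> {1..N} \<Longrightarrow> B n $ i $ i = 0"
  shows "\<exists>L>0. \<forall>\<nu> U. 0 < \<nu> \<and> \<nu> \<le> 1 / L \<and> riemannian_gd (ell N B \<epsilon>) (\<lambda>r. \<nu>) U \<longrightarrow>
    (\<forall>r. ell N B \<epsilon> (U (Suc r)) - ell N B \<epsilon> (U r) \<le> - (\<nu> / 2) * (norm (rgrad (ell N B \<epsilon>) (U r)))\<^sup>2) \<and>
    (\<nu> = 1 / L \<longrightarrow>
      (\<forall>r. ell N B \<epsilon> (U (Suc r)) - ell N B \<epsilon> (U r) \<le> - (1 / (2 * L)) * (norm (rgrad (ell N B \<epsilon>) (U r)))\<^sup>2)) \<and>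
    convergent (\<lambda>r. ell N B \<epsilon> (U r)) \<and>
    (\<lambda>r. rgrad (ell N B \<epsilon>) (U r)) \<longlonglongrightarrow> 0"
proof -
  \<comment> \<open>All orthogonal matrices have this Frobenius norm, so bounds on the sphere of
    radius \<open>c\<close> apply to every iterate.\<close>
  define c where "c = norm (mat 1 :: 'd sqmat)"
  define F where "F = ell N B \<epsilon>"
  obtain C where C: "0 \<le> C" and
    upper: "\<And>X Y. norm X = c \<Longrightarrow> norm Y = c \<Longrightarrow>
      F Y \<le> F X + inner (egrad F X) (Y - X) + C * (norm (Y - X))\<^sup>2"
    unfolding F_def using ell_upper_bound[OF \<open>\<epsilon> > 0\<close>] by blast
  obtain K where K: "0 \<le> K" and bound: "\<And>X. norm X = c \<Longrightarrow> norm (egrad F X) \<le> K"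
    unfolding F_def using egrad_ell_bounded[OF \<open>\<epsilon> > 0\<close>] by blast
  \<comment> \<open>Twice the second-order constant of the descent step; the added 1 keeps
    \<open>L\<close> positive even if \<open>K\<close> and \<open>C\<close> vanish.\<close>
  define L where "L = 2 * (2 * K + 4 * C) + 1"
  have L: "0 < L" using K C by (simp add: L_def)
  show ?thesis
    unfolding F_def[symmetric]
  proof (intro exI[of _ L] conjI allI L impI; elim conjE)
    fix \<nu> :: real and U :: "nat \<Rightarrow> 'd sqmat"
    assume \<nu>: "0 < \<nu>" "\<nu> \<le> 1 / L" and gd: "riemannian_gd F (\<lambda>r. \<nu>) U"
    have "\<nu> * L \<le> 1" using \<nu> L by (simp add: field_simps)
    then have \<nu>': "\<nu> * (2 * (2 * K + 4 * C)) \<le> 1"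
      using \<nu>(1) by (simp add: L_def distrib_left)
    have U0: "orthogonal_matrix (U 0)"
      and step: "U (Suc r) = Retr (U r) (- (\<nu> *\<^sub>R rgrad F (U r)))" for r
      using gd by (auto simp: riemannian_gd_def rotation_matrix_def)
    have on_sphere: "norm X = c" if "orthogonal_matrix X" for X :: "'d sqmat"
      using norm_orthogonal_matrix[OF that] by (simp add: c_def)
    have descent: "orthogonal_matrix (Retr X (- (\<nu> *\<^sub>R rgrad F X)))"
      "F (Retr X (- (\<nu> *\<^sub>R rgrad F X))) - F X \<le> - (\<nu> / 2) * (norm (rgrad F X))\<^sup>2"
      if "orthogonal_matrix X" for X
      using rgrad_descent_step[of F C K X \<nu>] upper bound on_sphere C that \<nu>(1) \<nu>' by blast+
    have orth: "orthogonal_matrix (U r)" for r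
      by (induction r) (simp_all add: U0 step descent(1))
    show dec: "F (U (Suc r)) - F (U r) \<le> - (\<nu> / 2) * (norm (rgrad F (U r)))\<^sup>2" for r
      using descent(2)[OF orth] by (simp add: step)
    show "F (U (Suc r)) - F (U r) \<le> - (1 / (2 * L)) * (norm (rgrad F (U r)))\<^sup>2" if "\<nu> = 1 / L" for r
      using dec[of r] that by (simp add: field_simps)
    have "0 \<le> F X" for X
      unfolding F_def ell_eq using \<open>\<epsilon> > 0\<close> mean_sq_ge[of \<epsilon> N B _ _ X]
      by (intro sum_nonneg) (auto intro: order_trans[of 0 \<epsilon>])
    from sufficient_decrease_convergence[of "\<nu> / 2" "\<lambda>r. F (U r)", OF _ this dec] \<nu>(1)
    show "convergent (\<lambda>r. F (U r))" and "(\<lambda>r. rgrad F (U r)) \<longlonglongrightarrow> 0" by auto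
  qed
qed

end
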